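(* For every four-dimensional rotating spacetime of separable (Carter) type as in the context, the radial ($s=r$) and the angular ($s=a$) pole-skipping data, both evaluated at $(\mathfrak w,k)=(\mathfrak w_n,k_n)$ at order $n$, each satisfy the polynomial constraints $$E^{(s)}_3(\lambda)-4E^{(s)}_2(\lambda)+5E^{(s)}_1(\lambda)=0,$$ $$E^{(s)}_4(\lambda)-10E^{(s)}_2(\lambda)+16E^{(s)}_1(\lambda)=0,$$ $$E^{(s)}_4(\lambda^2)-6E^{(s)}_3(\lambda^2)+14E^{(s)}_2(\lambda^2)-9E^{(s)}_2(\lambda)^2+40E^{(s)}_2(\lambda)E^{(s)}_1(\lambda)-46E^{(s)}_1(\lambda)^2=0,$$ for $s\in\{r,a\}$.
   Context: Metric: $ds^2=-\frac{f_1(r)}{Z}(dt-y_2(x)d\varphi)^2+\frac{y_1(x)}{Z}(a\,dt-f_2(r)d\varphi)^2+\frac{Z}{f_1(r)}dr^2+\frac{Z}{y_1(x)}dx^2$ with $Z=f_2(r)-a\,y_2(x)$ and rotation parameter $a$. Horizon at $r=r_h$: $f_1(r_h)=0$; Hawking temperature $T=\frac{f_1'(r_h)}{4\pi f_2(r_h)}>0$, horizon angular velocity $\Omega_H=a/f_2(r_h)$. Rotation axis at $x=x_0$: $y_1(x_0)=y_2(x_0)=0$, $y_1'(x_0)\neq0$. The functions $f_\alpha$ are analytic near $r_h$ and $y_\alpha$ near $x_0$. (No field equations are imposed on the metric.) A free scalar of mass $m$, $\Phi=e^{-i\omega t+ik\varphi}\Theta(x)\psi(r)$, separates, with separation constant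 $\lambda$ (treated as a complex variable), into $A\psi''+B\psi'+C\psi=0$ with $A=f_1^2$, $B=f_1f_1'$, $C=(ak-\omega f_2)^2-(\lambda+m^2f_2)f_1$ (radial), and $\tilde A\Theta''+\tilde B\Theta'+\tilde C\Theta=0$ with $\tilde A=y_1^2$, $\tilde B=y_1y_1'$, $\tilde C=-(k-\omega y_2)^2+(\lambda+am^2y_2)y_1$ (angular). Let $A_j,B_j,C_j$ be the coefficients of $(r-r_h)^j$ and $\tilde A_j,\tilde B_j,\tilde C_j$ those of $(x-x_0)^j$ (zero for $j<0$). For an exponent $\rho$ define $M_{KS}=A_{K-S+3}(\rho+S-1)(\rho+S-2)+B_{K-S+2}(\rho+S-1)+C_{K-S+1}$, the coefficient of $\phi_{S-1}$ at order $(r-r_h)^{\rho+K}$ when $\psi=(r-r_h)^\rho\sum_j\phi_j(r-r_h)^j$ is inserted; define $\tilde M_{KS}$ likewise for the angular equation. Put $\mathfrak w=\omega-k\Omega_H$, $\mathfrak w_n=-2\pi iTn$, $k_n=n\,y_1'(x_0)/2$, $\omega_n=\mathfrak w_n+k_n\Omega_H$. Both sectors are evaluated at $\omega=\omega_n$, $k=k_n$. Radial exponent: $\rho=-i\mathfrak w/(4\pi T)=-n/2$. Angular exponent: $\rho=-k/y_1'(x_0)=-n/2$. Then $\det(M_{KS})_{1\le K,S\le n}$ and $\det(\tilde M_{KS})_{1\le K,S\le n}$ are polynomials of degree $n$ in $\lambda$; their roots (with multiplicity) are the radial and angular pole-skipping values at order $n$, and $E^{(r)}_n(\lambda^l)$,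 $E^{(a)}_n(\lambda^l)$ are the degree-$l$ elementary symmetric polynomials of the radial and angular roots respectively. *)

theory Defs
  imports
    "HOL-Analysis.FPS_Convergence"
    "HOL-Computational_Algebra.Fundamental_Theorem_Algebra"
    "Jordan_Normal_Form.Determinant"
begin

(* The data of the line element
     ds^2 = - f1(r)/Z (dt - y2(x) dphi)^2 + y1(x)/Z (rot dt - f2(r) dphi)^2
            + Z/f1(r) dr^2 + Z/y1(x) dx^2,      Z = f2(r) - rot y2(x),
   together with the horizon radius and the position of the rotation axis. *)
record carter_metric =
  f1 :: "real \<Rightarrow> real"
  f2 :: "real \<Rightarrow> real"
  y1 :: "real \<Rightarrow> real"
  y2 :: "real \<Rightarrow> real"
  rot :: real
  r_hor :: real
  x_axis :: real

definition real_analytic_at :: "(real \<Rightarrow> real) \<Rightarrow> real \<Rightarrow> bool" where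
  "real_analytic_at f x \<longleftrightarrow> (\<exists>F. (\<lambda>h. f (x + h)) has_fps_expansion F)"

definition temperature :: "carter_metric \<Rightarrow> real" where
  "temperature G = deriv (f1 G) (r_hor G) / (4 * pi * f2 G (r_hor G))"

definition ang_velocity :: "carter_metric \<Rightarrow> real" where
  "ang_velocity G = rot G / f2 G (r_hor G)"

(* Division by zero is 0, so a positive temperature entails that
   f2 and the derivative of f1 do not vanish at the horizon. *)
definition carter_spacetime :: "carter_metric \<Rightarrow> bool" where
  "carter_spacetime G \<longleftrightarrow>
     real_analytic_at (f1 G) (r_hor G) \<and> real_analytic_at (f2 G) (r_hor G) \<and>
     real_analytic_at (y1 G) (x_axis G) \<and> real_analytic_at (y2 G) (x_axis G) \<and>
     f1 G (r_hor G) = 0 \<and> temperature G > 0 \<and>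
     y1 G (x_axis G) = 0 \<and> y2 G (x_axis G) = 0 \<and> deriv (y1 G) (x_axis G) \<noteq> 0"

definition taylor_coeff :: "(real \<Rightarrow> complex) \<Rightarrow> real \<Rightarrow> int \<Rightarrow> complex" where
  "taylor_coeff g x\<^sub>0 j = (if j < 0 then 0 else
     ((\<lambda>h x. vector_derivative h (at x)) ^^ nat j) g x\<^sub>0 / fact (nat j))"

definition rad_A :: "carter_metric \<Rightarrow> real \<Rightarrow> complex" where
  "rad_A G r = of_real ((f1 G r)\<^sup>2)"

definition rad_B :: "carter_metric \<Rightarrow> real \<Rightarrow> complex" where
  "rad_B G r = of_real (f1 G r * deriv (f1 G) r)"

(* \<Lambda> is the separation constant lambda. *)
definition rad_C :: "carter_metric \<Rightarrow> real \<Rightarrow> complex \<Rightarrow> complex \<Rightarrow> complex \<Rightarrow> real \<Rightarrow> complex" where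
  "rad_C G m \<omega> k \<Lambda> r =
     (of_real (rot G) * k - \<omega> * of_real (f2 G r))\<^sup>2
     - (\<Lambda> + of_real (m\<^sup>2 * f2 G r)) * of_real (f1 G r)"

definition ang_A :: "carter_metric \<Rightarrow> real \<Rightarrow> complex" where
  "ang_A G x = of_real ((y1 G x)\<^sup>2)"

definition ang_B :: "carter_metric \<Rightarrow> real \<Rightarrow> complex" where
  "ang_B G x = of_real (y1 G x * deriv (y1 G) x)"

definition ang_C :: "carter_metric \<Rightarrow> real \<Rightarrow> complex \<Rightarrow> complex \<Rightarrow> complex \<Rightarrow> real \<Rightarrow> complex" where
  "ang_C G m \<omega> k \<Lambda> x =
     - (k - \<omega> * of_real (y2 G x))\<^sup>2
     + (\<Lambda> + of_real (rot G * m\<^sup>2 * y2 G x)) * of_real (y1 G x)"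

(* Frobenius recursion of A u'' + B u' + C u = 0 about x0, u = (x - x0)^rho * (power series) *)
definition frobenius_entry ::
  "(real \<Rightarrow> complex) \<Rightarrow> (real \<Rightarrow> complex) \<Rightarrow> (real \<Rightarrow> complex) \<Rightarrow> real \<Rightarrow> complex \<Rightarrow> int \<Rightarrow> int \<Rightarrow> complex" where
  "frobenius_entry A B C x\<^sub>0 \<rho> K S =
     taylor_coeff A x\<^sub>0 (K - S + 3) * (\<rho> + of_int S - 1) * (\<rho> + of_int S - 2)
     + taylor_coeff B x\<^sub>0 (K - S + 2) * (\<rho> + of_int S - 1)
     + taylor_coeff C x\<^sub>0 (K - S + 1)"

(* Matrix indices of the library start at 0, those of M_KS at 1. *)
definition frobenius_det ::
  "(real \<Rightarrow> complex) \<Rightarrow> (real \<Rightarrow> complex) \<Rightarrow> (real \<Rightarrow> complex) \<Rightarrow> real \<Rightarrow> complex \<Rightarrow> nat \<Rightarrow> complex" where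
  "frobenius_det A B C x\<^sub>0 \<rho> n =
     Determinant.det (Matrix.mat n n (\<lambda>(i, j).
       frobenius_entry A B C x\<^sub>0 \<rho> (int i + 1) (int j + 1)))"

definition rad_exponent :: "carter_metric \<Rightarrow> complex \<Rightarrow> complex \<Rightarrow> complex" where
  "rad_exponent G \<omega> k =
     - \<i> * (\<omega> - k * of_real (ang_velocity G)) / of_real (4 * pi * temperature G)"

definition ang_exponent :: "carter_metric \<Rightarrow> complex \<Rightarrow> complex" where
  "ang_exponent G k = - k / of_real (deriv (y1 G) (x_axis G))"

definition k_ps :: "carter_metric \<Rightarrow> nat \<Rightarrow> complex" where
  "k_ps G n = of_nat n * of_real (deriv (y1 G) (x_axis G)) / 2"

(* the co-rotating frequency -2 pi i T n *)
definition w_ps :: "carter_metric \<Rightarrow> nat \<Rightarrow> complex" where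
  "w_ps G n = - 2 * of_real pi * \<i> * of_real (temperature G) * of_nat n"

definition \<omega>_ps :: "carter_metric \<Rightarrow> nat \<Rightarrow> complex" where
  "\<omega>_ps G n = w_ps G n + k_ps G n * of_real (ang_velocity G)"

definition rad_det :: "carter_metric \<Rightarrow> real \<Rightarrow> nat \<Rightarrow> complex \<Rightarrow> complex" where
  "rad_det G m n \<Lambda> =
     frobenius_det (rad_A G) (rad_B G) (rad_C G m (\<omega>_ps G n) (k_ps G n) \<Lambda>)
       (r_hor G) (rad_exponent G (\<omega>_ps G n) (k_ps G n)) n"

definition ang_det :: "carter_metric \<Rightarrow> real \<Rightarrow> nat \<Rightarrow> complex \<Rightarrow> complex" where
  "ang_det G m n \<Lambda> =
     frobenius_det (ang_A G) (ang_B G) (ang_C G m (\<omega>_ps G n) (k_ps G n) \<Lambda>)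
       (x_axis G) (ang_exponent G (k_ps G n)) n"

(* At most one polynomial has given values; rad_det and ang_det are polynomials
   in the separation constant, which enters C affinely. *)
definition poly_of_fun :: "(complex \<Rightarrow> complex) \<Rightarrow> complex poly" where
  "poly_of_fun D = (THE p. \<forall>z. poly p z = D z)"

(* proots counts roots with multiplicity *)
definition rad_values :: "carter_metric \<Rightarrow> real \<Rightarrow> nat \<Rightarrow> complex multiset" where
  "rad_values G m n = proots (poly_of_fun (rad_det G m n))"

definition ang_values :: "carter_metric \<Rightarrow> real \<Rightarrow> nat \<Rightarrow> complex multiset" where
  "ang_values G m n = proots (poly_of_fun (ang_det G m n))"

(* The pairs (x, i) with i < count R x enumerate the elements of R with repetition. *)
definition elem_sym :: "nat \<Rightarrow> complex multiset \<Rightarrow> complex" where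
  "elem_sym l R =
     (\<Sum>I | I \<subseteq> {(x, i). i < count R x} \<and> card I = l. \<Prod>p\<in>I. fst p)"

definition E_rad :: "carter_metric \<Rightarrow> real \<Rightarrow> nat \<Rightarrow> nat \<Rightarrow> complex" where
  "E_rad G m n l = elem_sym l (rad_values G m n)"

definition E_ang :: "carter_metric \<Rightarrow> real \<Rightarrow> nat \<Rightarrow> nat \<Rightarrow> complex" where
  "E_ang G m n l = elem_sym l (ang_values G m n)"

end

(* Both omega_n and k_n are linear in n, so in either sector the coefficient C at order n is
   n^2 P + Q + s lambda f with P and Q independent of n, f = f1 or y1, and s = -1 or 1. The
   pole-skipping frequency gives P_0 = - (f')^2 / 4, so the superdiagonal entries of the
   recursion matrix are (f')^2 K (K - n) and everything above them vanishes. Expanding this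
   lower Hessenberg determinant, the first and second elementary symmetric polynomials of its
   roots depend only on Taylor coefficients of f, P and Q of low order, and the constraints
   eliminate these. *)
theory Submission
  imports Defs
begin

section \<open>Power series along the real axis and Taylor coefficients\<close>

text \<open>\<open>has_fps_expansion\<close> keeps argument, value and coefficients in one field,
  whereas the coefficients of the separated equations are complex functions of a real variable.
  These are therefore matched with the restriction of a complex power series to the real
  axis.\<close>

definition has_real_expansion :: "(real \<Rightarrow> complex) \<Rightarrow> real \<Rightarrow> complex fps \<Rightarrow> bool" where
  "has_real_expansion g x\<^sub>0 G \<longleftrightarrow> fps_conv_radius G > 0 \<and>
     (\<forall>\<^sub>F h in nhds 0. g (x\<^sub>0 + h) = eval_fps G (of_real h))"

lemma eventually_nhds_of_real:
  assumes "\<forall>\<^sub>F z in nhds (0::complex). P z"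
  shows "\<forall>\<^sub>F h in nhds (0::real). P (of_real h)"
proof -
  have "((of_real :: real \<Rightarrow> complex) \<longlongrightarrow> of_real 0) (nhds 0)"
    by (intro tendsto_intros filterlim_ident)
  then show ?thesis
    using assms by (simp add: filterlim_iff)
qed

lemma has_real_expansionI:
  assumes "f has_fps_expansion G" "\<forall>\<^sub>F h in nhds 0. g (x\<^sub>0 + h) = f (of_real h)"
  shows "has_real_expansion g x\<^sub>0 G"
proof -
  have "\<forall>\<^sub>F h in nhds (0::real). eval_fps G (of_real h) = f (of_real h)"
    using assms(1) by (intro eventually_nhds_of_real) (simp add: has_fps_expansion_def)
  with assms(2) have "\<forall>\<^sub>F h in nhds 0. g (x\<^sub>0 + h) = eval_fps G (of_real h)"
    by eventually_elim simp
  with assms(1) show ?thesis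
    by (simp add: has_real_expansion_def has_fps_expansion_def)
qed

lemma has_real_expansion_const: "has_real_expansion (\<lambda>x. c) x\<^sub>0 (fps_const c)"
  by (rule has_real_expansionI[OF has_fps_expansion_const]) simp

lemma has_real_expansion_add:
  assumes "has_real_expansion f x\<^sub>0 F" "has_real_expansion g x\<^sub>0 G"
  shows "has_real_expansion (\<lambda>x. f x + g x) x\<^sub>0 (F + G)"
proof (rule has_real_expansionI)
  show "(\<lambda>z. eval_fps F z + eval_fps G z) has_fps_expansion F + G"
    using assms by (intro has_fps_expansion_add eval_fps_has_fps_expansion)
      (simp_all add: has_real_expansion_def)
  show "\<forall>\<^sub>F h in nhds 0. f (x\<^sub>0 + h) + g (x\<^sub>0 + h) = eval_fps F (of_real h) + eval_fps G (of_real h)"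
    using assms unfolding has_real_expansion_def by (auto elim: eventually_elim2)
qed

lemma has_real_expansion_mult:
  assumes "has_real_expansion f x\<^sub>0 F" "has_real_expansion g x\<^sub>0 G"
  shows "has_real_expansion (\<lambda>x. f x * g x) x\<^sub>0 (F * G)"
proof (rule has_real_expansionI)
  show "(\<lambda>z. eval_fps F z * eval_fps G z) has_fps_expansion F * G"
    using assms by (intro has_fps_expansion_mult eval_fps_has_fps_expansion)
      (simp_all add: has_real_expansion_def)
  show "\<forall>\<^sub>F h in nhds 0. f (x\<^sub>0 + h) * g (x\<^sub>0 + h) = eval_fps F (of_real h) * eval_fps G (of_real h)"
    using assms unfolding has_real_expansion_def by (auto elim: eventually_elim2)
qed

text \<open>The radius of convergence depends only on the norms of the coefficients, so making them
  complex preserves it; inside the disc \<open>of_real\<close> commutes with the infinite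
  sum.\<close>

lemma has_real_expansion_of_real:
  assumes "(\<lambda>h. f (x\<^sub>0 + h)) has_fps_expansion F"
  shows "has_real_expansion (\<lambda>x. of_real (f x)) x\<^sub>0 (Abs_fps (\<lambda>n. of_real (fps_nth F n)))"
    (is "has_real_expansion _ _ ?F")
proof -
  have rad: "fps_conv_radius ?F = fps_conv_radius F"
    by (simp add: fps_conv_radius_def conv_radius_def)
  have pos: "fps_conv_radius F > 0"
    using assms by (simp add: has_fps_expansion_def)
  have "\<forall>\<^sub>F h in nhds 0. h \<in> eball 0 (fps_conv_radius F)"
    using pos by (intro eventually_nhds_in_open) (auto simp: zero_ereal_def)
  moreover have "\<forall>\<^sub>F h in nhds 0. eval_fps F h = f (x\<^sub>0 + h)"
    using assms by (simp add: has_fps_expansion_def)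
  ultimately have "\<forall>\<^sub>F h in nhds 0. of_real (f (x\<^sub>0 + h)) = eval_fps ?F (of_real h)"
  proof eventually_elim
    case (elim h)
    then have "summable (\<lambda>n. fps_nth F n * h ^ n)"
      by (intro summable_fps) simp
    then have "of_real (\<Sum>n. fps_nth F n * h ^ n) = (\<Sum>n. of_real (fps_nth F n * h ^ n) :: complex)"
      by (rule suminf_of_real)
    with elim show ?case
      by (simp add: eval_fps_def)
  qed
  with pos show ?thesis
    by (simp add: has_real_expansion_def rad)
qed

lemma has_fps_expansion_deriv_shift:
  fixes f :: "real \<Rightarrow> real"
  assumes "(\<lambda>h. f (x\<^sub>0 + h)) has_fps_expansion F"
  shows "(\<lambda>h. deriv f (x\<^sub>0 + h)) has_fps_expansion fps_deriv F"
proof -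
  have "deriv (\<lambda>h. f (x\<^sub>0 + h)) = (\<lambda>h. deriv f (x\<^sub>0 + h))"
    by (auto simp: fun_eq_iff deriv_def DERIV_shift add.commute)
  with has_fps_expansion_deriv[OF assms] show ?thesis by simp
qed

text \<open>Near the base point \<open>g\<close> is the restriction of a holomorphic function, and
  the complex derivative of that function on the real axis is the vector derivative of
  \<open>g\<close>. The result is again an expansion, so the argument can be iterated.\<close>

lemma has_real_expansion_vector_derivative:
  assumes "has_real_expansion g x\<^sub>0 G"
  shows "has_real_expansion (\<lambda>x. vector_derivative g (at x)) x\<^sub>0 (fps_deriv G)"
proof -
  have pos: "fps_conv_radius G > 0"
    using assms by (simp add: has_real_expansion_def)
  have "\<forall>\<^sub>F z in nhds (0::complex). z \<in> eball 0 (fps_conv_radius G)"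
    using pos by (intro eventually_nhds_in_open) (auto simp: zero_ereal_def)
  then have "\<forall>\<^sub>F h in nhds 0. of_real h \<in> eball (0::complex) (fps_conv_radius G)"
    by (rule eventually_nhds_of_real)
  \<comment> \<open>Differentiating at \<open>h\<close> takes the identity on a neighbourhood of
    \<open>h\<close>, not only at \<open>h\<close>; \<open>eventually_eventually\<close> supplies
    this for all \<open>h\<close> near 0.\<close>
  moreover have "\<forall>\<^sub>F h in nhds 0. \<forall>\<^sub>F k in nhds h. g (x\<^sub>0 + k) = eval_fps G (of_real k)"
    using assms by (simp add: has_real_expansion_def eventually_eventually)
  ultimately have "\<forall>\<^sub>F h in nhds 0.
    vector_derivative g (at (x\<^sub>0 + h)) = eval_fps (fps_deriv G) (of_real h)"
  proof eventually_elim
    case (elim h)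
    have "(eval_fps G has_field_derivative eval_fps (fps_deriv G) (of_real h)) (at (of_real h))"
      using elim by (intro has_field_derivative_eval_fps) simp
    then have "((\<lambda>k. eval_fps G (of_real k)) has_vector_derivative
        eval_fps (fps_deriv G) (of_real h)) (at h)"
      by (rule has_vector_derivative_real_field)
    then have "((\<lambda>k. g (x\<^sub>0 + k)) has_vector_derivative eval_fps (fps_deriv G) (of_real h)) (at h)"
      using elim(2) by (subst has_vector_derivative_cong_ev[where g = "\<lambda>k. eval_fps G (of_real k)"])
        (auto dest: eventually_nhds_x_imp_x)
    then have "((\<lambda>k. g (x\<^sub>0 + k)) \<circ> (\<lambda>x. x - x\<^sub>0) has_vector_derivative
        1 *\<^sub>R eval_fps (fps_deriv G) (of_real h)) (at (x\<^sub>0 + h))"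
      by (intro vector_diff_chain_at) (auto intro!: derivative_eq_intros)
    then have "(g has_vector_derivative eval_fps (fps_deriv G) (of_real h)) (at (x\<^sub>0 + h))"
      by (simp add: o_def)
    then show ?case
      by (rule vector_derivative_at)
  qed
  then show ?thesis
    using pos fps_conv_radius_deriv[of G] by (auto simp: has_real_expansion_def)
qed

text \<open>Trades the iterated derivatives in \<open>taylor_coeff\<close> for formal coefficients,
  so that the matrix entries can be found by power series multiplication.\<close>

lemma taylor_coeff_eq_fps_nth:
  assumes "has_real_expansion g x\<^sub>0 G"
  shows "taylor_coeff g x\<^sub>0 j = (if j < 0 then 0 else fps_nth G (nat j))"
proof -
  have "((\<lambda>h x. vector_derivative h (at x)) ^^ n) g x\<^sub>0 = fact n * fps_nth G n" for n
    using assms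
  proof (induction n arbitrary: g G)
    case 0
    then have "g (x\<^sub>0 + 0) = eval_fps G (of_real 0)"
      unfolding has_real_expansion_def by (blast dest: eventually_nhds_x_imp_x)
    then show ?case
      by (simp add: eval_fps_at_0)
  next
    \<comment> \<open>The innermost derivative is peeled off, hence the generalisation over
      \<open>g\<close> and \<open>G\<close>; the factor \<open>Suc n\<close> from
      \<open>fps_deriv\<close> completes the factorial.\<close>
    case (Suc n)
    then have "((\<lambda>h x. vector_derivative h (at x)) ^^ n) (\<lambda>x. vector_derivative g (at x)) x\<^sub>0
        = fact n * fps_nth (fps_deriv G) n"
      by (blast intro: has_real_expansion_vector_derivative)
    then show ?case
      by (simp add: funpow_Suc_right algebra_simps del: funpow.simps)
  qed
  then show ?thesis
    by (simp add: taylor_coeff_def)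
qed

section \<open>Elementary symmetric polynomials of roots\<close>

text \<open>The pairs index a multiset by a finite set, as \<open>elem_sym\<close> does, so that a
  product over the multiset can be multiplied out over subsets with \<open>prod_add\<close>.\<close>

lemma prod_count_pairs:
  "(\<Prod>p | snd p < count R (fst p). f (fst p)) = (\<Prod>x\<in>#R. f x)"
proof -
  have "{p. snd p < count R (fst p)} = (SIGMA x:set_mset R. {..<count R x})"
    by (auto simp: count_greater_zero_iff[symmetric] simp del: count_greater_zero_iff)
  then have "(\<Prod>p | snd p < count R (fst p). f (fst p))
      = (\<Prod>(x, i)\<in>(SIGMA x:set_mset R. {..<count R x}). f x)"
    by (simp add: case_prod_unfold)
  also have "\<dots> = (\<Prod>x\<in>set_mset R. \<Prod>i<count R x. f x)"
    by (rule prod.Sigma[symmetric]) auto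
  also have "\<dots> = (\<Prod>x\<in>#R. f x)"
    by (simp add: image_prod_mset_multiplicity)
  finally show ?thesis .
qed

text \<open>Multiplying out the linear factors means choosing from each one either its constant or
  the variable. The choices with exactly \<open>l\<close> constants make up the coefficient in
  question.\<close>

lemma elem_sym_vieta:
  assumes "l \<le> size R"
  shows "coeff (\<Prod>x\<in>#R. [:- x, 1:]) (size R - l) = (- 1) ^ l * elem_sym l R"
proof -
  define X where "X = {p. snd p < count R (fst p)}"
  have "X = (SIGMA x:set_mset R. {..<count R x})"
    by (auto simp: X_def count_greater_zero_iff[symmetric] simp del: count_greater_zero_iff)
  then have fin: "finite X" and card: "card X = size R"
    by (auto simp: size_multiset_overloaded_eq)
  \<comment> \<open>\<open>I\<close> is the set of factors that contribute their constant; the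
    factors in \<open>X - I\<close> contribute the variable.\<close>
  have term_coeff: "coeff ((\<Prod>p\<in>I. [:- fst p:]) * (\<Prod>p\<in>X - I. [:0, 1:])) (size R - l)
      = (if card I = l then (- 1) ^ l * (\<Prod>p\<in>I. fst p) else 0)" if "I \<subseteq> X" for I
  proof -
    have le: "card I \<le> size R" and diff: "card (X - I) = size R - card I"
      using that fin card by (auto simp: card_mono card_Diff_subset finite_subset simp flip: card)
    have "(\<Prod>p\<in>I. [:- fst p:]) = [:(- 1) ^ card I * (\<Prod>p\<in>I. fst p):]"
      using finite_subset[OF that fin] by (induction I rule: finite_induct) auto
    moreover have "(\<Prod>p\<in>X - I. [:0, 1:]) = monom (1::complex) (size R - card I)"
      by (simp add: diff monom_altdef)
    \<comment> \<open>Both \<open>l\<close> and \<open>card I\<close> are at most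
      \<open>size R\<close>, so the truncated differences agree only if
      \<open>card I = l\<close>.\<close>
    ultimately show ?thesis
      using assms le by (auto simp: coeff_monom)
  qed
  have "(\<Prod>x\<in>#R. [:- x, 1:]) = (\<Prod>p\<in>X. [:- fst p:] + [:0, 1:])"
    by (simp add: X_def prod_count_pairs[symmetric])
  also have "\<dots> = (\<Sum>I\<in>Pow X. (\<Prod>p\<in>I. [:- fst p:]) * (\<Prod>p\<in>X - I. [:0, 1:]))"
    using fin by (rule prod_add)
  finally have "coeff (\<Prod>x\<in>#R. [:- x, 1:]) (size R - l)
      = (\<Sum>I\<in>Pow X. if card I = l then (- 1) ^ l * (\<Prod>p\<in>I. fst p) else 0)"
    by (simp add: coeff_sum term_coeff del: prod_constant)
  also have "\<dots> = (\<Sum>I | I \<subseteq> X \<and> card I = l. (- 1) ^ l * (\<Prod>p\<in>I. fst p))"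
    using fin by (intro sum.mono_neutral_cong_right) auto
  also have "\<dots> = (- 1) ^ l * elem_sym l R"
    by (simp add: elem_sym_def X_def sum_distrib_left case_prod_unfold)
  finally show ?thesis .
qed

text \<open>A complex polynomial is determined by its values, which evaluates the description in
  \<open>poly_of_fun\<close>, and it has as many roots as its degree. Vieta's formula then applies
  after division by the leading coefficient.\<close>

lemma elem_sym_proots:
  assumes "\<And>z. D z = poly p z" "degree p = n" "p \<noteq> 0" "l \<le> n"
  shows "elem_sym l (proots (poly_of_fun D)) = (- 1) ^ l * coeff p (n - l) / coeff p n"
proof -
  have "poly_of_fun D = p"
    unfolding poly_of_fun_def using assms(1) by (intro the_equality) (auto simp: poly_eq_poly_eq_iff[symmetric])
  moreover have "size (proots p) = n"
    using assms(2) by (simp add: size_proots_complex)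
  moreover have "coeff p (n - l) = coeff p n * coeff (\<Prod>x\<in>#proots p. [:- x, 1:]) (n - l)"
    using assms(2) by (subst complex_poly_decompose_multiset[of p, symmetric]) simp
  ultimately have "coeff p (n - l) = coeff p n * ((- 1) ^ l * elem_sym l (proots (poly_of_fun D)))"
    using elem_sym_vieta[of l "proots p"] assms(4) by simp
  moreover have "coeff p n \<noteq> 0"
    using assms(2,3) by auto
  ultimately show ?thesis
    by simp
qed

section \<open>Lower Hessenberg determinants of order at most four\<close>

text \<open>Laplace expansion along the first row, with the minor again in the form
  \<open>Matrix.mat\<close>, so that repeated rewriting evaluates a determinant of concrete
  size.\<close>

lemma det_mat_Suc:
  "Determinant.det (Matrix.mat (Suc n) (Suc n) f) =
     (\<Sum>j<Suc n. f (0, j) * ((- 1) ^ j *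
       Determinant.det (Matrix.mat n n (\<lambda>(i, k). f (Suc i, if k < j then k else Suc k)))))"
proof -
  have "mat_delete (Matrix.mat (Suc n) (Suc n) f) 0 j
      = Matrix.mat n n (\<lambda>(i, k). f (Suc i, if k < j then k else Suc k))" for j
    by (rule eq_matI) (auto simp: mat_delete_def)
  then show ?thesis
    using laplace_expansion_row[of "Matrix.mat (Suc n) (Suc n) f" "Suc n" 0]
    by (simp add: cofactor_def)
qed

text \<open>The polynomial variable is the separation constant. Its coefficient \<open>b\<close>
  depends only on the distance from the diagonal, and the superdiagonal is free of it.\<close>

definition hessenberg_entry ::
  "(nat \<Rightarrow> complex) \<Rightarrow> (nat \<Rightarrow> complex) \<Rightarrow> (nat \<Rightarrow> nat \<Rightarrow> complex) \<Rightarrow> (nat \<Rightarrow> complex) \<Rightarrow>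
    nat \<Rightarrow> nat \<Rightarrow> complex poly" where
  "hessenberg_entry u a g b i j =
     (if j \<le> i then [:if i = j then a i else g i j, b (i - j):] else if j = Suc i then [:u i:] else 0)"

text \<open>Each superdiagonal factor \<open>u\<close> in a term of the determinant lowers its
  degree by at least one. The two coefficients below the leading one thus involve at most two such
  factors: one pairs with an entry \<open>g\<close> or \<open>b 1\<close> just below the diagonal;
  two adjacent ones pair with \<open>b 2\<close>, and two disjoint ones, first possible at order
  four, give the \<open>(b 1)\<^sup>2\<close> term.\<close>

lemma elem_sym_hessenberg:
  fixes u a :: "nat \<Rightarrow> complex" and g b
  defines "E \<equiv> \<lambda>n l. elem_sym l (proots (poly_of_fun (\<lambda>z.
    Determinant.det (Matrix.mat n n (\<lambda>(i, j). poly (hessenberg_entry u a g b i j) z)))))"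
  assumes b: "b 0 \<noteq> 0"
  shows "E 1 1 = - a 0 / b 0"
    and "E 2 1 = - (a 0 + a 1) / b 0 + b 1 * u 0 / (b 0)\<^sup>2"
    and "E 2 2 = (a 0 * a 1 - u 0 * g 1 0) / (b 0)\<^sup>2"
    and "E 3 1 = - (a 0 + a 1 + a 2) / b 0 + b 1 * (u 0 + u 1) / (b 0)\<^sup>2"
    and "E 3 2 = (a 0 * a 1 + a 0 * a 2 + a 1 * a 2 - u 0 * g 1 0 - u 1 * g 2 1) / (b 0)\<^sup>2
      - (b 1 * (u 0 * a 2 + u 1 * a 0) - b 2 * u 0 * u 1) / (b 0)^3"
    and "E 4 1 = - (a 0 + a 1 + a 2 + a 3) / b 0 + b 1 * (u 0 + u 1 + u 2) / (b 0)\<^sup>2"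
    and "E 4 2 = (a 0 * a 1 + a 0 * a 2 + a 0 * a 3 + a 1 * a 2 + a 1 * a 3 + a 2 * a 3
        - u 0 * g 1 0 - u 1 * g 2 1 - u 2 * g 3 2) / (b 0)\<^sup>2
      - (b 1 * (u 0 * (a 2 + a 3) + u 1 * (a 0 + a 3) + u 2 * (a 0 + a 1))
         - b 2 * (u 0 * u 1 + u 1 * u 2)) / (b 0)^3
      + (b 1)\<^sup>2 * u 0 * u 2 / (b 0)^4"
proof -
  define p where "p = hessenberg_entry u a g b"
  define D where "D = (\<lambda>n z. Determinant.det (Matrix.mat n n (\<lambda>(i, j). poly (p i j) z)))"
  have E: "E n l = elem_sym l (proots (poly_of_fun (D n)))" for n l
    by (simp add: E_def D_def p_def)
  note p_simps = p_def hessenberg_entry_def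
  \<comment> \<open>These are the Laplace expansions with the zero entries above the superdiagonal
    already dropped.\<close>
  define p1 where "p1 = p 0 0"
  define p2 where "p2 = p 0 0 * p 1 1 - p 0 1 * p 1 0"
  define p3 where "p3 = p 0 0 * (p 1 1 * p 2 2 - p 1 2 * p 2 1)
    - p 0 1 * (p 1 0 * p 2 2 - p 1 2 * p 2 0)"
  define p4 where "p4 = p 0 0 * (p 1 1 * (p 2 2 * p 3 3 - p 2 3 * p 3 2)
      - p 1 2 * (p 2 1 * p 3 3 - p 2 3 * p 3 1))
    - p 0 1 * (p 1 0 * (p 2 2 * p 3 3 - p 2 3 * p 3 2)
      - p 1 2 * (p 2 0 * p 3 3 - p 2 3 * p 3 0))"
  note expand = D_def det_mat_Suc lessThan_Suc p_simps numeral_eq_Suc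
  have D: "D 1 z = poly p1 z" "D 2 z = poly p2 z" "D 3 z = poly p3 z" "D 4 z = poly p4 z" for z
    by (simp_all add: expand p1_def p2_def p3_def p4_def) (simp_all add: algebra_simps)
  have p: "p 0 0 = [:a 0, b 0:]" "p 1 1 = [:a 1, b 0:]" "p 2 2 = [:a 2, b 0:]" "p 3 3 = [:a 3, b 0:]"
    "p 1 0 = [:g 1 0, b 1:]" "p 2 1 = [:g 2 1, b 1:]" "p 3 2 = [:g 3 2, b 1:]"
    "p 2 0 = [:g 2 0, b 2:]" "p 3 1 = [:g 3 1, b 2:]" "p 3 0 = [:g 3 0, b 3:]"
    "p 0 1 = [:u 0:]" "p 1 2 = [:u 1:]" "p 2 3 = [:u 2:]"
    by (simp_all add: p_simps)
  \<comment> \<open>Only the diagonal product reaches degree \<open>n\<close>; its leading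
    coefficient is the \<open>n\<close>-th power of \<open>b 0\<close>.\<close>
  have deg: "degree p1 = 1" "degree p2 = 2" "degree p3 = 3" "degree p4 = 4"
    using b unfolding p1_def p2_def p3_def p4_def p by simp_all
  then have nz: "p1 \<noteq> 0" "p2 \<noteq> 0" "p3 \<noteq> 0" "p4 \<noteq> 0"
    by auto
  have "E 1 1 = - coeff p1 0 / coeff p1 1"
    unfolding E using elem_sym_proots[OF D(1) deg(1) nz(1), of 1] by simp
  then show "E 1 1 = - a 0 / b 0"
    unfolding p1_def p by simp
  have "E 2 1 = - coeff p2 1 / coeff p2 2"
    unfolding E using elem_sym_proots[OF D(2) deg(2) nz(2), of 1] by simp
  then show "E 2 1 = - (a 0 + a 1) / b 0 + b 1 * u 0 / (b 0)\<^sup>2"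
    using b unfolding p2_def p by (simp add: numeral_eq_Suc) (simp add: field_simps)
  have "E 2 2 = coeff p2 0 / coeff p2 2"
    unfolding E using elem_sym_proots[OF D(2) deg(2) nz(2), of 2] by simp
  then show "E 2 2 = (a 0 * a 1 - u 0 * g 1 0) / (b 0)\<^sup>2"
    using b unfolding p2_def p by (simp add: numeral_eq_Suc)
  have "E 3 1 = - coeff p3 2 / coeff p3 3"
    unfolding E using elem_sym_proots[OF D(3) deg(3) nz(3), of 1] by simp
  then show "E 3 1 = - (a 0 + a 1 + a 2) / b 0 + b 1 * (u 0 + u 1) / (b 0)\<^sup>2"
    using b unfolding p3_def p by (simp add: numeral_eq_Suc) (simp add: field_simps)
  have "E 3 2 = coeff p3 1 / coeff p3 3"
    unfolding E using elem_sym_proots[OF D(3) deg(3) nz(3), of 2] by simp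
  then show "E 3 2 = (a 0 * a 1 + a 0 * a 2 + a 1 * a 2 - u 0 * g 1 0 - u 1 * g 2 1) / (b 0)\<^sup>2
      - (b 1 * (u 0 * a 2 + u 1 * a 0) - b 2 * u 0 * u 1) / (b 0)^3"
    using b unfolding p3_def p by (simp add: numeral_eq_Suc) (simp add: field_simps)
  have "E 4 1 = - coeff p4 3 / coeff p4 4"
    unfolding E using elem_sym_proots[OF D(4) deg(4) nz(4), of 1] by simp
  then show "E 4 1 = - (a 0 + a 1 + a 2 + a 3) / b 0 + b 1 * (u 0 + u 1 + u 2) / (b 0)\<^sup>2"
    using b unfolding p4_def p by (simp add: numeral_eq_Suc) (simp add: field_simps)
  have "E 4 2 = coeff p4 2 / coeff p4 4"
    unfolding E using elem_sym_proots[OF D(4) deg(4) nz(4), of 2] by simp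
  then show "E 4 2 = (a 0 * a 1 + a 0 * a 2 + a 0 * a 3 + a 1 * a 2 + a 1 * a 3 + a 2 * a 3
        - u 0 * g 1 0 - u 1 * g 2 1 - u 2 * g 3 2) / (b 0)\<^sup>2
      - (b 1 * (u 0 * (a 2 + a 3) + u 1 * (a 0 + a 3) + u 2 * (a 0 + a 1))
         - b 2 * (u 0 * u 1 + u 1 * u 2)) / (b 0)^3
      + (b 1)\<^sup>2 * u 0 * u 2 / (b 0)^4"
    using b unfolding p4_def p by (simp add: numeral_eq_Suc) (simp add: field_simps)
qed

section \<open>The Frobenius matrix and the constraints in a form common to both sectors\<close>

text \<open>Above the superdiagonal the index into \<open>A'\<close> is at most 1, into
  \<open>B'\<close> at most 0 and into \<open>C'\<close> negative. The double zero of
  \<open>A\<close> and the zero of \<open>B\<close> therefore make the matrix lower Hessenberg;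
  elsewhere the natural number subtractions are exact.\<close>

lemma frobenius_entry_fps:
  assumes "has_real_expansion A x\<^sub>0 A'" "has_real_expansion B x\<^sub>0 B'" "has_real_expansion C x\<^sub>0 C'"
    and "fps_nth A' 0 = 0" "fps_nth A' 1 = 0" "fps_nth B' 0 = 0"
  shows "frobenius_entry A B C x\<^sub>0 \<rho> (int i + 1) (int j + 1) =
    (if j \<le> Suc i
     then fps_nth A' (i + 3 - j) * (\<rho> + of_nat j) * (\<rho> + of_nat j - 1)
       + fps_nth B' (i + 2 - j) * (\<rho> + of_nat j) + fps_nth C' (i + 1 - j)
     else 0)"
proof -
  have "taylor_coeff A x\<^sub>0 (int i - int j + 3) = (if j \<le> Suc i then fps_nth A' (i + 3 - j) else 0)"
  proof (cases "j \<le> i + 1")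
    case True
    then have "nat (int i - int j + 3) = i + 3 - j" by simp
    with True show ?thesis by (simp add: taylor_coeff_eq_fps_nth[OF assms(1)])
  next
    case False
    then have "int i - int j + 3 < 0 \<or> nat (int i - int j + 3) = 0 \<or> nat (int i - int j + 3) = 1"
      by linarith
    with False assms(4,5) show ?thesis by (auto simp: taylor_coeff_eq_fps_nth[OF assms(1)])
  qed
  moreover have "taylor_coeff B x\<^sub>0 (int i - int j + 2) = (if j \<le> Suc i then fps_nth B' (i + 2 - j) else 0)"
  proof (cases "j \<le> i + 1")
    case True
    then have "nat (int i - int j + 2) = i + 2 - j" by simp
    with True show ?thesis by (simp add: taylor_coeff_eq_fps_nth[OF assms(2)])
  next
    case False
    then have "int i - int j + 2 < 0 \<or> nat (int i - int j + 2) = 0"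
      by linarith
    with False assms(6) show ?thesis by (auto simp: taylor_coeff_eq_fps_nth[OF assms(2)])
  qed
  moreover have "taylor_coeff C x\<^sub>0 (int i - int j + 1) = (if j \<le> Suc i then fps_nth C' (i + 1 - j) else 0)"
  proof (cases "j \<le> i + 1")
    case True
    then have "nat (int i - int j + 1) = i + 1 - j" by simp
    with True show ?thesis by (simp add: taylor_coeff_eq_fps_nth[OF assms(3)])
  qed (simp add: taylor_coeff_eq_fps_nth[OF assms(3)])
  ultimately show ?thesis
    by (simp add: frobenius_entry_def algebra_simps)
qed

text \<open>\<open>F\<close> stands for the series of \<open>f1\<close> or \<open>y1\<close>. The
  values of \<open>P\<close> and \<open>Q\<close> at order 0 make \<open>- n / 2\<close> a root of
  the indicial equation.\<close>

lemma pole_skipping_constraints: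
  fixes F P Q :: "complex fps" and s :: complex and A B :: "real \<Rightarrow> complex" and x\<^sub>0 :: real
    and C :: "nat \<Rightarrow> complex \<Rightarrow> real \<Rightarrow> complex"
  defines "E \<equiv> \<lambda>n l. elem_sym l (proots (poly_of_fun (\<lambda>\<Lambda>.
    frobenius_det A B (C n \<Lambda>) x\<^sub>0 (- of_nat n / 2) n)))"
  assumes A: "has_real_expansion A x\<^sub>0 (F * F)"
    and B: "has_real_expansion B x\<^sub>0 (F * fps_deriv F)"
    and C: "\<And>n \<Lambda>. has_real_expansion (C n \<Lambda>) x\<^sub>0
      (fps_const ((of_nat n)\<^sup>2) * P + Q + fps_const (s * \<Lambda>) * F)"
    and F: "fps_nth F 0 = 0" "fps_nth F 1 \<noteq> 0"
    and P: "fps_nth P 0 = - (fps_nth F 1)\<^sup>2 / 4"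
    and Q: "fps_nth Q 0 = 0"
    and s: "s \<noteq> 0"
  shows "E 3 1 - 4 * E 2 1 + 5 * E 1 1 = 0"
    and "E 4 1 - 10 * E 2 1 + 16 * E 1 1 = 0"
    and "E 4 2 - 6 * E 3 2 + 14 * E 2 2 - 9 * (E 2 1)\<^sup>2 + 40 * E 2 1 * E 1 1 - 46 * (E 1 1)\<^sup>2 = 0"
proof -
  \<comment> \<open>\<open>\<alpha>\<close> is the part of an entry free of
    \<open>\<Lambda>\<close>, with the exponent \<open>- n / 2\<close> inserted, and
    \<open>b\<close> is the coefficient of \<open>\<Lambda>\<close>, which comes from
    \<open>s * \<Lambda>\<close> times \<open>F\<close>.\<close>
  define \<alpha> where "\<alpha> = (\<lambda>n i j. fps_nth (F * F) (i + 3 - j) * (of_nat j - of_nat n / 2) * (of_nat j - of_nat n / 2 - 1)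
       + fps_nth (F * fps_deriv F) (i + 2 - j) * (of_nat j - of_nat n / 2)
       + (of_nat n)\<^sup>2 * fps_nth P (i + 1 - j) + fps_nth Q (i + 1 - j))"
  define b where "b = (\<lambda>d. s * fps_nth F (d + 1))"
  define u where "u = (\<lambda>n j. (fps_nth F 1)\<^sup>2 * of_nat (j + 1) * (of_nat (j + 1) - of_nat n :: complex))"
  define f f2 f3 where "f = fps_nth F 1" and "f2 = fps_nth F 2" and "f3 = fps_nth F 3"
  have f: "f \<noteq> 0" using F(2) by (simp add: f_def)
  have FF: "fps_nth (F * F) 0 = 0" "fps_nth (F * F) 1 = 0" "fps_nth (F * F) 2 = f\<^sup>2"
    "fps_nth (F * F) 3 = 2 * f * f2" "fps_nth (F * F) 4 = 2 * f * f3 + f2\<^sup>2"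
    using F(1) by (simp_all add: fps_mult_nth f_def f2_def f3_def numeral_eq_Suc power2_eq_square)
  have FF': "fps_nth (F * fps_deriv F) 0 = 0" "fps_nth (F * fps_deriv F) 1 = f\<^sup>2"
    "fps_nth (F * fps_deriv F) 2 = 3 * f * f2" "fps_nth (F * fps_deriv F) 3 = 4 * f * f3 + 2 * f2\<^sup>2"
    using F(1) by (simp_all add: fps_mult_nth f_def f2_def f3_def numeral_eq_Suc power2_eq_square)
  have entry: "frobenius_entry A B (C n \<Lambda>) x\<^sub>0 (- of_nat n / 2) (int i + 1) (int j + 1)
      = poly (hessenberg_entry (u n) (\<lambda>i. \<alpha> n i i) (\<alpha> n) b i j) \<Lambda>" for n \<Lambda> i j
  proof -
    consider "j \<le> i" | "j = Suc i" | "j > Suc i" by linarith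
    then show ?thesis
    proof cases
      case 1
      then have "i + 1 - j = i - j + 1" by simp
      then show ?thesis
        unfolding frobenius_entry_fps[OF A B C FF(1,2) FF'(1)]
        using 1 by (simp add: hessenberg_entry_def \<alpha>_def b_def algebra_simps)
    next
      \<comment> \<open>With \<open>K = i + 1\<close> the exponent is \<open>K - n / 2\<close>, and
        the entry is \<open>f\<^sup>2\<close> times the difference of the squares of
        \<open>K - n / 2\<close> and \<open>n / 2\<close>. It vanishes at \<open>K = n\<close>,
        which closes the first \<open>n\<close> equations on \<open>n\<close> unknowns.\<close>
      case 2
      have "i + 3 - Suc i = 2" "i + 2 - Suc i = 1" "i + 1 - Suc i = 0" by simp_all
      then show ?thesis
        unfolding frobenius_entry_fps[OF A B C FF(1,2) FF'(1)] 2
        by (simp add: hessenberg_entry_def u_def FF FF' F P Q flip: f_def One_nat_def)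
          (simp add: field_simps power2_eq_square)
    next
      case 3
      then show ?thesis
        unfolding frobenius_entry_fps[OF A B C FF(1,2) FF'(1)]
        by (simp add: hessenberg_entry_def)
    qed
  qed
  have b0: "b 0 \<noteq> 0"
    using s f by (simp add: b_def f_def)
  have E: "E n l = elem_sym l (proots (poly_of_fun (\<lambda>z. Determinant.det (Matrix.mat n n
      (\<lambda>(i, j). poly (hessenberg_entry (u n) (\<lambda>i. \<alpha> n i i) (\<alpha> n) b i j) z)))))" for n l
    by (simp only: E_def frobenius_det_def entry)
  \<comment> \<open>Dividing the first-order coefficients by \<open>f\<close> exposes a factor
    \<open>f\<close> in every diagonal entry, which cancels against
    \<open>b 0 = s * f\<close>.\<close>
  define p1 q1 p2 q2 where "p1 = fps_nth P 1 / f" and "q1 = fps_nth Q 1 / f"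
    and "p2 = fps_nth P 2" and "q2 = fps_nth Q 2"
  have diag: "\<alpha> n i i = f * (f2 * (of_nat i - of_nat n / 2) * (2 * of_nat i - of_nat n + 1)
      + (of_nat n)\<^sup>2 * p1 + q1)" for n i
    using f by (simp add: \<alpha>_def p1_def q1_def FF FF' flip: One_nat_def) (simp add: field_simps)
  \<comment> \<open>The coefficient of \<open>F * fps_deriv F\<close> at order 3 is twice that of
    \<open>F * F\<close> at order 4, since the former series is half the derivative of the latter;
    this merges the two terms into one product.\<close>
  have sub: "\<alpha> n (Suc i) i = (2 * f * f3 + f2\<^sup>2) * (of_nat i - of_nat n / 2) * (of_nat i - of_nat n / 2 + 1)
      + (of_nat n)\<^sup>2 * p2 + q2" for n i
  proof -
    have "Suc i + 3 - i = 4" "Suc i + 2 - i = 3" "Suc i + 1 - i = 2" by simp_all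
    then show ?thesis
      unfolding \<alpha>_def by (simp only: FF FF' p2_def q2_def) (simp add: field_simps)
  qed
  have sub': "\<alpha> n 1 0 = (2 * f * f3 + f2\<^sup>2) * (- of_nat n / 2) * (- of_nat n / 2 + 1)
      + (of_nat n)\<^sup>2 * p2 + q2"
    "\<alpha> n 2 1 = (2 * f * f3 + f2\<^sup>2) * (1 - of_nat n / 2) * (2 - of_nat n / 2)
      + (of_nat n)\<^sup>2 * p2 + q2"
    "\<alpha> n 3 2 = (2 * f * f3 + f2\<^sup>2) * (2 - of_nat n / 2) * (3 - of_nat n / 2)
      + (of_nat n)\<^sup>2 * p2 + q2" for n
    using sub[of n 0] sub[of n 1] sub[of n 2] by (simp_all add: numeral_eq_Suc)
  have bs: "b 0 = s * f" "b 1 = s * f2" "b 2 = s * f3"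
    by (simp_all add: b_def f_def f2_def f3_def numeral_eq_Suc)
  have us: "u n j = f\<^sup>2 * of_nat (j + 1) * (of_nat (j + 1) - of_nat n)" for n j
    by (simp add: u_def f_def)
  note vieta = elem_sym_hessenberg[where b = b, OF b0]
  have E11: "E 1 1 = - (p1 + q1) / s"
    using s f by (simp only: E vieta diag sub' bs us) (simp add: field_simps)
  have E21: "E 2 1 = - (2 * f2 + 8 * p1 + 2 * q1) / s"
    using s f by (simp only: E vieta diag sub' bs us) (simp add: field_simps power2_eq_square)
  have E31: "E 3 1 = - (8 * f2 + 27 * p1 + 3 * q1) / s"
    using s f by (simp only: E vieta diag sub' bs us) (simp add: field_simps power2_eq_square)
  have E41: "E 4 1 = - (20 * f2 + 64 * p1 + 4 * q1) / s"
    using s f by (simp only: E vieta diag sub' bs us) (simp add: field_simps power2_eq_square)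
  have E22: "E 2 2 = (4 * f2 * p1 + f2 * q1 + 16 * p1\<^sup>2 + 8 * p1 * q1 + q1\<^sup>2 + 4 * p2 + q2) / s\<^sup>2"
    using s f by (simp only: E vieta diag sub' bs us) (simp add: field_simps power2_eq_square)
  have E32: "E 3 2 = (12 * f2\<^sup>2 + 108 * f2 * p1 + 12 * f2 * q1 + 243 * p1\<^sup>2 + 54 * p1 * q1 + 3 * q1\<^sup>2
      + 6 * f * f3 + 36 * p2 + 4 * q2) / s\<^sup>2"
    using s f by (simp only: E vieta diag sub' bs us) (simp add: field_simps power_numeral_reduce)
  have E42: "E 4 2 = (108 * f2\<^sup>2 + 800 * f2 * p1 + 50 * f2 * q1 + 1536 * p1\<^sup>2 + 192 * p1 * q1 + 6 * q1\<^sup>2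
      + 36 * f * f3 + 160 * p2 + 10 * q2) / s\<^sup>2"
    using s f by (simp only: E vieta diag sub' bs us) (simp add: field_simps power_numeral_reduce)
  \<comment> \<open>As linear forms in \<open>f2\<close>, \<open>p1\<close>, \<open>q1\<close> the
    four first symmetric polynomials span only a plane, so those of orders 3 and 4 are combinations
    of those of orders 1 and 2.\<close>
  show "E 3 1 - 4 * E 2 1 + 5 * E 1 1 = 0" "E 4 1 - 10 * E 2 1 + 16 * E 1 1 = 0"
    using s unfolding E11 E21 E31 E41 by (simp_all add: field_simps)
  \<comment> \<open>The weights 1, -6, 14 cancel \<open>p2\<close>, \<open>q2\<close> and
    \<open>f * f3\<close>. The remaining quadratic form in \<open>f2\<close>, \<open>p1\<close>,
    \<open>q1\<close> is a quadratic form in \<open>E 2 1\<close> and \<open>E 1 1\<close>.\<close>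
  show "E 4 2 - 6 * E 3 2 + 14 * E 2 2 - 9 * (E 2 1)\<^sup>2 + 40 * E 2 1 * E 1 1 - 46 * (E 1 1)\<^sup>2 = 0"
    using s unfolding E11 E21 E22 E32 E42 by (simp add: field_simps power2_eq_square)
qed

section \<open>The radial and the angular sector\<close>

lemma has_real_expansion_power2:
  assumes "has_real_expansion f x\<^sub>0 F"
  shows "has_real_expansion (\<lambda>x. (f x)\<^sup>2) x\<^sub>0 (F * F)"
  using has_real_expansion_mult[OF assms assms] by (simp add: power2_eq_square)

lemma has_real_expansion_cmult:
  assumes "has_real_expansion f x\<^sub>0 F"
  shows "has_real_expansion (\<lambda>x. c * f x) x\<^sub>0 (fps_const c * F)"
  by (rule has_real_expansion_mult[OF has_real_expansion_const assms])

lemma real_analytic_at_expansion: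
  assumes "real_analytic_at f x\<^sub>0"
  obtains F where "has_real_expansion (\<lambda>x. of_real (f x)) x\<^sub>0 F"
    "has_real_expansion (\<lambda>x. of_real (deriv f x)) x\<^sub>0 (fps_deriv F)"
    "fps_nth F 0 = of_real (f x\<^sub>0)" "fps_nth F 1 = of_real (deriv f x\<^sub>0)"
proof -
  from assms obtain F where F: "(\<lambda>h. f (x\<^sub>0 + h)) has_fps_expansion F"
    by (auto simp: real_analytic_at_def)
  note dF = has_fps_expansion_deriv_shift[OF F]
  have "fps_deriv (Abs_fps (\<lambda>n. of_real (fps_nth F n))) =
      (Abs_fps (\<lambda>n. of_real (fps_nth (fps_deriv F) n)) :: complex fps)"
    by (simp add: fps_eq_iff)
  moreover have "fps_nth F 0 = f x\<^sub>0"
    using F by (auto simp: has_fps_expansion_def eval_fps_at_0 dest!: eventually_nhds_x_imp_x)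
  moreover have "fps_nth (fps_deriv F) 0 = deriv f x\<^sub>0"
    using dF unfolding has_fps_expansion_def
    by (auto simp: eval_fps_at_0 dest!: eventually_nhds_x_imp_x)
  ultimately show thesis
    using that has_real_expansion_of_real[OF F] has_real_expansion_of_real[OF dF] by simp
qed

text \<open>The common form applies with \<open>s = - 1\<close>: the squared term of
  \<open>rad_C\<close> is homogeneous in frequency and wave number and gives \<open>P\<close>, while
  the mass term gives \<open>Q\<close> and vanishes at the horizon with \<open>f1\<close>.\<close>

lemma rad_pole_skipping_constraints:
  fixes G :: carter_metric and m :: real
  assumes "carter_spacetime G"
  defines "E \<equiv> E_rad G m"
  shows "E 3 1 - 4 * E 2 1 + 5 * E 1 1 = 0"
    and "E 4 1 - 10 * E 2 1 + 16 * E 1 1 = 0"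
    and "E 4 2 - 6 * E 3 2 + 14 * E 2 2 - 9 * (E 2 1)\<^sup>2 + 40 * E 2 1 * E 1 1 - 46 * (E 1 1)\<^sup>2 = 0"
proof -
  define x where "x = r_hor G"
  from assms(1) have ana: "real_analytic_at (f1 G) x" "real_analytic_at (f2 G) x"
    and f1: "f1 G x = 0" and T: "temperature G > 0"
    by (auto simp: carter_spacetime_def x_def)
  from T have nz: "deriv (f1 G) x \<noteq> 0" "f2 G x \<noteq> 0"
    by (auto simp: temperature_def x_def)
  obtain F where F: "has_real_expansion (\<lambda>r. of_real (f1 G r)) x F"
    "has_real_expansion (\<lambda>r. of_real (deriv (f1 G) r)) x (fps_deriv F)"
    "fps_nth F 0 = of_real (f1 G x)" "fps_nth F 1 = of_real (deriv (f1 G) x)"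
    using real_analytic_at_expansion[OF ana(1)] .
  obtain H where H: "has_real_expansion (\<lambda>r. of_real (f2 G r)) x H"
    "fps_nth H 0 = of_real (f2 G x)"
    using real_analytic_at_expansion[OF ana(2)] by metis
  define U where "U = fps_const (of_real (rot G) * k_ps G 1) - fps_const (\<omega>_ps G 1) * H"
  define Q where "Q = - (fps_const (of_real (m\<^sup>2)) * H * F)"
  have "has_real_expansion (\<lambda>r. of_real (rot G) * k_ps G 1 + (- \<omega>_ps G 1) * of_real (f2 G r)) x
      (fps_const (of_real (rot G) * k_ps G 1) + fps_const (- \<omega>_ps G 1) * H)"
    by (intro has_real_expansion_add has_real_expansion_const has_real_expansion_cmult H)
  then have U: "has_real_expansion (\<lambda>r. of_real (rot G) * k_ps G 1 - \<omega>_ps G 1 * of_real (f2 G r)) x U"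
    by (simp add: U_def fps_const_neg[symmetric] del: fps_const_neg)
  have A: "has_real_expansion (rad_A G) x (F * F)"
    using has_real_expansion_power2[OF F(1)] by (simp add: rad_A_def[abs_def])
  have B: "has_real_expansion (rad_B G) x (F * fps_deriv F)"
    using has_real_expansion_mult[OF F(1,2)] by (simp add: rad_B_def[abs_def])
  have lin: "\<omega>_ps G n = of_nat n * \<omega>_ps G 1" "k_ps G n = of_nat n * k_ps G 1" for n
    by (simp_all add: \<omega>_ps_def w_ps_def k_ps_def algebra_simps)
  \<comment> \<open>The factor \<open>- 1\<close> stays written out so that the last summand has the
    shape \<open>s * \<Lambda>\<close>.\<close>
  have C: "has_real_expansion (rad_C G m (\<omega>_ps G n) (k_ps G n) \<Lambda>) x
      (fps_const ((of_nat n)\<^sup>2) * (U * U) + Q + fps_const (- 1 * \<Lambda>) * F)" for n \<Lambda>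
  proof -
    have "has_real_expansion (\<lambda>r. (of_nat n)\<^sup>2 * (of_real (rot G) * k_ps G 1 - \<omega>_ps G 1 * of_real (f2 G r))\<^sup>2
        + of_real (- m\<^sup>2) * (of_real (f2 G r) * of_real (f1 G r)) + (- 1 * \<Lambda>) * of_real (f1 G r)) x
      (fps_const ((of_nat n)\<^sup>2) * (U * U) + fps_const (of_real (- m\<^sup>2)) * (H * F) + fps_const (- 1 * \<Lambda>) * F)"
      by (intro has_real_expansion_add has_real_expansion_cmult has_real_expansion_mult
          has_real_expansion_power2 U F H)
    moreover have "fps_const (of_real (- m\<^sup>2)) * (H * F) = Q"
      by (simp add: Q_def mult.assoc fps_const_neg[symmetric] del: fps_const_neg)
    moreover have "rad_C G m (\<omega>_ps G n) (k_ps G n) \<Lambda> =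
      (\<lambda>r. (of_nat n)\<^sup>2 * (of_real (rot G) * k_ps G 1 - \<omega>_ps G 1 * of_real (f2 G r))\<^sup>2
        + of_real (- m\<^sup>2) * (of_real (f2 G r) * of_real (f1 G r)) + (- 1 * \<Lambda>) * of_real (f1 G r))"
      unfolding lin[of n] rad_C_def by (intro ext) (simp add: algebra_simps power2_eq_square)
    ultimately show ?thesis by simp
  qed
  \<comment> \<open>Since \<open>rot G\<close> is \<open>ang_velocity G\<close> times
    \<open>f2\<close> at the horizon, only the co-rotating frequency survives there; inserting the
    temperature then cancels \<open>f2\<close>.\<close>
  have "fps_nth U 0 = - w_ps G 1 * of_real (f2 G x)"
    using nz by (simp add: U_def H \<omega>_ps_def ang_velocity_def x_def field_simps)
  also have "\<dots> = \<i> / 2 * of_real (deriv (f1 G) x)"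
    using nz by (simp add: w_ps_def temperature_def x_def field_simps)
  finally have U0: "fps_nth U 0 = \<i> / 2 * of_real (deriv (f1 G) x)" .
  have P: "fps_nth (U * U) 0 = - (fps_nth F 1)\<^sup>2 / 4"
    by (simp add: U0 F flip: One_nat_def) (simp add: algebra_simps power2_eq_square)
  have exponent: "rad_exponent G (\<omega>_ps G n) (k_ps G n) = - of_nat n / 2" for n
    using T by (simp add: rad_exponent_def \<omega>_ps_def w_ps_def field_simps)
  have E: "E = (\<lambda>n l. elem_sym l (proots (poly_of_fun (\<lambda>\<Lambda>.
      frobenius_det (rad_A G) (rad_B G) (rad_C G m (\<omega>_ps G n) (k_ps G n) \<Lambda>) x (- of_nat n / 2) n))))"
    by (simp add: E_def E_rad_def[abs_def] rad_values_def rad_det_def[abs_def] exponent x_def)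
  have "fps_nth F 0 = 0" "fps_nth F 1 \<noteq> 0" "fps_nth Q 0 = 0" "- 1 \<noteq> (0 :: complex)"
    using nz f1 by (simp_all add: F Q_def flip: One_nat_def)
  note * = pole_skipping_constraints[where C = "\<lambda>n. rad_C G m (\<omega>_ps G n) (k_ps G n)",
      OF A B C this(1,2) P this(3,4), folded E]
  show "E 3 1 - 4 * E 2 1 + 5 * E 1 1 = 0"
    and "E 4 1 - 10 * E 2 1 + 16 * E 1 1 = 0"
    and "E 4 2 - 6 * E 3 2 + 14 * E 2 2 - 9 * (E 2 1)\<^sup>2 + 40 * E 2 1 * E 1 1 - 46 * (E 1 1)\<^sup>2 = 0"
    using * by (simp_all add: E)
qed

text \<open>The common form applies with \<open>s = 1\<close>. Because \<open>y2\<close> vanishes on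
  the axis, the order 0 value of \<open>P\<close> comes from \<open>k_ps G 1\<close>, half the slope
  of \<open>y1\<close>, alone.\<close>

lemma ang_pole_skipping_constraints:
  fixes G :: carter_metric and m :: real
  assumes "carter_spacetime G"
  defines "E \<equiv> E_ang G m"
  shows "E 3 1 - 4 * E 2 1 + 5 * E 1 1 = 0"
    and "E 4 1 - 10 * E 2 1 + 16 * E 1 1 = 0"
    and "E 4 2 - 6 * E 3 2 + 14 * E 2 2 - 9 * (E 2 1)\<^sup>2 + 40 * E 2 1 * E 1 1 - 46 * (E 1 1)\<^sup>2 = 0"
proof -
  define x where "x = x_axis G"
  from assms(1) have ana: "real_analytic_at (y1 G) x" "real_analytic_at (y2 G) x"
    and axis: "y1 G x = 0" "y2 G x = 0" "deriv (y1 G) x \<noteq> 0"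
    by (auto simp: carter_spacetime_def x_def)
  obtain F where F: "has_real_expansion (\<lambda>r. of_real (y1 G r)) x F"
    "has_real_expansion (\<lambda>r. of_real (deriv (y1 G) r)) x (fps_deriv F)"
    "fps_nth F 0 = of_real (y1 G x)" "fps_nth F 1 = of_real (deriv (y1 G) x)"
    using real_analytic_at_expansion[OF ana(1)] .
  obtain H where H: "has_real_expansion (\<lambda>r. of_real (y2 G r)) x H"
    "fps_nth H 0 = of_real (y2 G x)"
    using real_analytic_at_expansion[OF ana(2)] by metis
  define U where "U = fps_const (k_ps G 1) + fps_const (- \<omega>_ps G 1) * H"
  define P where "P = fps_const (- 1) * (U * U)"
  define Q where "Q = fps_const (of_real (rot G * m\<^sup>2)) * (H * F)"
  have U: "has_real_expansion (\<lambda>r. k_ps G 1 + (- \<omega>_ps G 1) * of_real (y2 G r)) x U"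
    unfolding U_def
    by (intro has_real_expansion_add has_real_expansion_const has_real_expansion_cmult H)
  have A: "has_real_expansion (ang_A G) x (F * F)"
    using has_real_expansion_power2[OF F(1)] by (simp add: ang_A_def[abs_def])
  have B: "has_real_expansion (ang_B G) x (F * fps_deriv F)"
    using has_real_expansion_mult[OF F(1,2)] by (simp add: ang_B_def[abs_def])
  have lin: "\<omega>_ps G n = of_nat n * \<omega>_ps G 1" "k_ps G n = of_nat n * k_ps G 1" for n
    by (simp_all add: \<omega>_ps_def w_ps_def k_ps_def algebra_simps)
  have C: "has_real_expansion (ang_C G m (\<omega>_ps G n) (k_ps G n) \<Lambda>) x
      (fps_const ((of_nat n)\<^sup>2) * P + Q + fps_const (1 * \<Lambda>) * F)" for n \<Lambda>
  proof -
    have "has_real_expansion (\<lambda>r. (of_nat n)\<^sup>2 * (- 1 * (k_ps G 1 + (- \<omega>_ps G 1) * of_real (y2 G r))\<^sup>2)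
        + of_real (rot G * m\<^sup>2) * (of_real (y2 G r) * of_real (y1 G r)) + 1 * \<Lambda> * of_real (y1 G r)) x
      (fps_const ((of_nat n)\<^sup>2) * P + Q + fps_const (1 * \<Lambda>) * F)"
      unfolding P_def Q_def
      by (intro has_real_expansion_add has_real_expansion_cmult has_real_expansion_mult
          has_real_expansion_power2 U F H)
    moreover have "ang_C G m (\<omega>_ps G n) (k_ps G n) \<Lambda> =
      (\<lambda>r. (of_nat n)\<^sup>2 * (- 1 * (k_ps G 1 + (- \<omega>_ps G 1) * of_real (y2 G r))\<^sup>2)
        + of_real (rot G * m\<^sup>2) * (of_real (y2 G r) * of_real (y1 G r)) + 1 * \<Lambda> * of_real (y1 G r))"
      unfolding lin[of n] ang_C_def by (intro ext) (simp add: algebra_simps power2_eq_square)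
    ultimately show ?thesis by simp
  qed
  have P: "fps_nth P 0 = - (fps_nth F 1)\<^sup>2 / 4"
    using axis by (simp add: P_def U_def H F k_ps_def x_def power2_eq_square flip: One_nat_def)
  have exponent: "ang_exponent G (k_ps G n) = - of_nat n / 2" for n
    using axis by (simp add: ang_exponent_def k_ps_def x_def)
  have E: "E = (\<lambda>n l. elem_sym l (proots (poly_of_fun (\<lambda>\<Lambda>.
      frobenius_det (ang_A G) (ang_B G) (ang_C G m (\<omega>_ps G n) (k_ps G n) \<Lambda>) x (- of_nat n / 2) n))))"
    by (simp add: E_def E_ang_def[abs_def] ang_values_def ang_det_def[abs_def] exponent x_def)
  have "fps_nth F 0 = 0" "fps_nth F 1 \<noteq> 0" "fps_nth Q 0 = 0" "1 \<noteq> (0 :: complex)"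
    using axis by (simp_all add: F Q_def flip: One_nat_def)
  note * = pole_skipping_constraints[where C = "\<lambda>n. ang_C G m (\<omega>_ps G n) (k_ps G n)",
      OF A B C this(1,2) P this(3,4), folded E]
  show "E 3 1 - 4 * E 2 1 + 5 * E 1 1 = 0"
    and "E 4 1 - 10 * E 2 1 + 16 * E 1 1 = 0"
    and "E 4 2 - 6 * E 3 2 + 14 * E 2 2 - 9 * (E 2 1)\<^sup>2 + 40 * E 2 1 * E 1 1 - 46 * (E 1 1)\<^sup>2 = 0"
    using * by (simp_all add: E)
qed

theorem mainTheorem9:
  fixes G :: carter_metric and m :: real
  assumes "carter_spacetime G"
  shows "\<forall>E \<in> {E_rad G m, E_ang G m}.
      E 3 1 - 4 * E 2 1 + 5 * E 1 1 = 0 \<and>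
      E 4 1 - 10 * E 2 1 + 16 * E 1 1 = 0 \<and>
      E 4 2 - 6 * E 3 2 + 14 * E 2 2 - 9 * (E 2 1)\<^sup>2 + 40 * E 2 1 * E 1 1 - 46 * (E 1 1)\<^sup>2 = 0"
  using rad_pole_skipping_constraints[OF assms, of m] ang_pole_skipping_constraints[OF assms, of m]
  by simp

end
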